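(* Let $\boldsymbol{s}=(s_1,\ldots,s_n)\in\mathbb{Z}_{\ge1}^n$ and $\boldsymbol{t}=(t_1,\ldots,t_m)\in\mathbb{Z}_{\ge1}^m$, and let $(\boldsymbol{s},1,\boldsymbol{t})=(s_1,\ldots,s_n,1,t_1,\ldots,t_m)\in\mathbb{Z}_{\ge1}^{n+m+1}$. If both lecture hall polytopes $\mathbf{P}_n^{(\boldsymbol{s})}$ and $\mathbf{P}_m^{(\boldsymbol{t})}$ are level, then $\mathbf{P}_{n+m+1}^{(\boldsymbol{s},1,\boldsymbol{t})}$ is level.
   Context: For $\boldsymbol{s}=(s_1,\ldots,s_n)\in\mathbb{Z}_{\ge1}^n$, the $\boldsymbol{s}$-lecture hall polytope is $$\mathbf{P}_n^{(\boldsymbol{s})}=\left\{\boldsymbol{\lambda}\in\mathbb{R}^n : 0\leq\frac{\lambda_1}{s_1}\leq\cdots\leq\frac{\lambda_n}{s_n}\leq 1\right\},$$ a lattice simplex. Levelness: for a lattice polytope $P\subset\mathbb{R}^n$ with vertex set $V(P)$, $\mathrm{cone}(P)=\mathrm{span}_{\mathbb{R}_{\ge0}}\{(\boldsymbol{v},1):\boldsymbol{v}\in V(P)\}\subset\mathbb{R}^{n+1}$, with relative interior $\mathrm{cone}(P)^\circ$. $P$ is level if the semigroup algebra $k[P]=k[\mathrm{cone}(P)\cap\mathbb{Z}^{n+1}]$ ($k$ an algebraically closed field of characteristic zero, graded by the last coordinate) is level, i.e. its canonical module $k[\mathrm{cone}(P)^\circ\cap\mathbb{Z}^{n+1}]$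 is generated by elements of the same degree; equivalently, there are finitely many $\boldsymbol{c}_1,\ldots,\boldsymbol{c}_m\in\mathbb{Z}^{n+1}$, all with the same last coordinate, such that $\bigcup_{i=1}^m\bigl(\boldsymbol{c}_i+(\mathrm{cone}(P)\cap\mathbb{Z}^{n+1})\bigr)=\mathrm{cone}(P)^\circ\cap\mathbb{Z}^{n+1}$. *)

theory Defs
  imports "HOL-Analysis.Analysis" "HOL-Analysis.Finite_Function_Topology"
begin

text \<open>
  Vectors of length \<open>n\<close> are elements of \<open>nat \<Rightarrow>\<^sub>0 real\<close> supported on \<open>{..<n}\<close>, so that polytopes of
  different dimensions live in one type; the coordinates are numbered from 0. The norm of that type
  restricts to a norm on each of these finite-dimensional subspaces, hence relative interiors are
  the usual ones. The ambient space of the cone over such a polytope is \<open>(nat \<Rightarrow>\<^sub>0 real) \<times> real\<close>, with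
  the grading given by the second component.
\<close>

definition lecture_hall_polytope :: "nat list \<Rightarrow> (nat \<Rightarrow>\<^sub>0 real) set" where
  "lecture_hall_polytope s =
     {x. Poly_Mapping.keys x \<subseteq> {..<length s} \<and>
         sorted (0 # map (\<lambda>i. Poly_Mapping.lookup x i / real (s ! i)) [0..<length s] @ [1])}"

definition cone_over :: "(nat \<Rightarrow>\<^sub>0 real) set \<Rightarrow> ((nat \<Rightarrow>\<^sub>0 real) \<times> real) set" where
  "cone_over P = convex_cone hull {(v, 1) | v. v extreme_point_of P}"

definition lattice_points :: "((nat \<Rightarrow>\<^sub>0 real) \<times> real) set" where
  "lattice_points = {(x, h). (\<forall>i. Poly_Mapping.lookup x i \<in> \<int>) \<and> h \<in> \<int>}"

text \<open>
  The product on \<open>'v \<Rightarrow>\<^sub>0 'k\<close> is convolution, so this type is the group algebra of \<open>'v\<close> over \<open>'k\<close>, with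
  \<open>Poly_Mapping.single u 1\<close> as the monomial with exponent \<open>u\<close>. The elements supported on \<open>S\<close> form
  the \<open>'k\<close>-span of the monomials with exponent in \<open>S\<close>.
\<close>

definition monomial_span :: "'v set \<Rightarrow> ('v \<Rightarrow>\<^sub>0 'k::zero) set" where
  "monomial_span S = {f. Poly_Mapping.keys f \<subseteq> S}"

definition semigroup_algebra ::
    "(nat \<Rightarrow>\<^sub>0 real) set \<Rightarrow> (((nat \<Rightarrow>\<^sub>0 real) \<times> real) \<Rightarrow>\<^sub>0 'k::zero) set" where
  "semigroup_algebra P = monomial_span (cone_over P \<inter> lattice_points)"

definition canonical_module ::
    "(nat \<Rightarrow>\<^sub>0 real) set \<Rightarrow> (((nat \<Rightarrow>\<^sub>0 real) \<times> real) \<Rightarrow>\<^sub>0 'k::zero) set" where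
  "canonical_module P = monomial_span (rel_interior (cone_over P) \<inter> lattice_points)"

definition homogeneous :: "int \<Rightarrow> (('v \<times> real) \<Rightarrow>\<^sub>0 'k::zero) \<Rightarrow> bool" where
  "homogeneous d f \<longleftrightarrow> (\<forall>u \<in> Poly_Mapping.keys f. snd u = of_int d)"

definition generated_submodule :: "'r::comm_ring_1 set \<Rightarrow> 'r set \<Rightarrow> 'r set" where
  "generated_submodule A G = {\<Sum>g\<in>F. a g * g | F a. finite F \<and> F \<subseteq> G \<and> (\<forall>g\<in>F. a g \<in> A)}"

text \<open>
  Semigroup algebras of lattice polytopes are normal, hence Cohen-Macaulay, so the
  Cohen-Macaulay condition in the general notion of a level algebra is not repeated here.
\<close>

definition level ::
    "'k::{alg_closed_field, field_char_0} itself \<Rightarrow> (nat \<Rightarrow>\<^sub>0 real) set \<Rightarrow> bool" where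
  "level k P \<longleftrightarrow>
     (\<exists>d. \<exists>G \<subseteq> (canonical_module P :: (((nat \<Rightarrow>\<^sub>0 real) \<times> real) \<Rightarrow>\<^sub>0 'k) set).
        (\<forall>g\<in>G. homogeneous d g) \<and>
        generated_submodule (semigroup_algebra P) G = canonical_module P)"

end

(* For positive s the cone over the lecture hall polytope of s is cut out, inside the vectors of
   length n, by the n + 1 linear functionals h_j = x_j / s_j - x_(j-1) / s_(j-1) (with x_(-1) / s_(-1)
   read as 0 and x_n / s_n read as the height), and its relative interior by the strict
   inequalities. An entry 1 in the middle forces the corresponding coordinate k of a lattice point
   to be an integer, so that (x, k, y, h) can be cut into the lattice points (x, k) and
   (y - k t, h - k). This identifies the semigroup of (s, 1, t), its interior and its height
   function with the product of those of s and t, with heights added. Levelness means that every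
   interior lattice point is an interior lattice point of a fixed height plus a lattice point of
   the cone, and this property passes to the product. *)

theory Submission
  imports Defs
begin

section \<open>Levelness in terms of lattice points\<close>

lemma keys_sum_subset: "Poly_Mapping.keys (sum f A) \<subseteq> (\<Union>i\<in>A. Poly_Mapping.keys (f i))"
proof (induction A rule: infinite_finite_induct)
  case (insert i A)
  then show ?case
    using keys_add[of "f i" "sum f A"] by auto
qed auto

lemma sum_single_keys:
  fixes f :: "'v \<Rightarrow>\<^sub>0 'k::comm_monoid_add"
  shows "(\<Sum>u\<in>Poly_Mapping.keys f. Poly_Mapping.single u (Poly_Mapping.lookup f u)) = f"
  by (rule poly_mapping_eqI)
    (simp add: lookup_sum lookup_single when_def in_keys_iff)

text \<open>Both modules are spanned by monomials, so generation can be tested on supports. The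
  hypothesis \<open>add\<close> says that the interior points absorb the cone points, which keeps
  the submodule generated by interior monomials inside the canonical module.\<close>

lemma level_iff:
  fixes P :: "(nat \<Rightarrow>\<^sub>0 real) set"
  defines "C \<equiv> cone_over P \<inter> lattice_points" and "I \<equiv> rel_interior (cone_over P) \<inter> lattice_points"
  assumes add: "\<And>c p. c \<in> I \<Longrightarrow> p \<in> C \<Longrightarrow> c + p \<in> I"
  shows "level TYPE('k::{alg_closed_field, field_char_0}) P \<longleftrightarrow>
    (\<exists>d::int. \<forall>u\<in>I. \<exists>c\<in>I. \<exists>p\<in>C. u = c + p \<and> snd c = of_int d)"
proof
  assume "level TYPE('k) P"
  then obtain d and G :: "(((nat \<Rightarrow>\<^sub>0 real) \<times> real) \<Rightarrow>\<^sub>0 'k) set"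
    where G: "G \<subseteq> canonical_module P" "\<forall>g\<in>G. homogeneous d g"
      and gen: "generated_submodule (semigroup_algebra P) G = canonical_module P"
    unfolding level_def by blast
  have "\<exists>c\<in>I. \<exists>p\<in>C. u = c + p \<and> snd c = of_int d" if "u \<in> I" for u
  proof -
    have "(Poly_Mapping.single u 1 :: _ \<Rightarrow>\<^sub>0 'k) \<in> canonical_module P"
      using that by (simp add: canonical_module_def monomial_span_def I_def)
    then obtain F a where F: "finite F" "F \<subseteq> G" "\<forall>g\<in>F. a g \<in> semigroup_algebra P"
      and eq: "(Poly_Mapping.single u 1 :: _ \<Rightarrow>\<^sub>0 'k) = (\<Sum>g\<in>F. a g * g)"
      unfolding gen[symmetric] generated_submodule_def by blast
    \<comment> \<open>Cancellation can only shrink supports, so the exponent \<open>u\<close> must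
      already occur in one product \<open>a g * g\<close>, as an exponent of \<open>a g\<close> plus
      one of \<open>g\<close>.\<close>
    have "u \<in> Poly_Mapping.keys (\<Sum>g\<in>F. a g * g)"
      unfolding eq[symmetric] by simp
    then obtain g where g: "g \<in> F" "u \<in> Poly_Mapping.keys (a g * g)"
      using keys_sum_subset[of "\<lambda>g. a g * g" F] by blast
    then obtain p c where pc: "u = p + c" "p \<in> Poly_Mapping.keys (a g)" "c \<in> Poly_Mapping.keys g"
      using keys_mult[of "a g" g] by blast
    have "p \<in> C"
      using pc g F by (auto simp: semigroup_algebra_def monomial_span_def C_def)
    moreover have "c \<in> I"
      using pc g F G by (fastforce simp: canonical_module_def monomial_span_def I_def)
    moreover have "snd c = of_int d"
      using pc g F G by (auto simp: homogeneous_def)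
    ultimately show ?thesis
      using pc(1) by (metis add.commute)
  qed
  then show "\<exists>d::int. \<forall>u\<in>I. \<exists>c\<in>I. \<exists>p\<in>C. u = c + p \<and> snd c = of_int d"
    by blast
next
  assume "\<exists>d::int. \<forall>u\<in>I. \<exists>c\<in>I. \<exists>p\<in>C. u = c + p \<and> snd c = of_int d"
  then obtain d :: int where "\<forall>u\<in>I. \<exists>c p. c \<in> I \<and> p \<in> C \<and> u = c + p \<and> snd c = of_int d"
    by blast
  then obtain \<gamma> \<pi> where split: "\<And>u. u \<in> I \<Longrightarrow>
      \<gamma> u \<in> I \<and> \<pi> u \<in> C \<and> u = \<gamma> u + \<pi> u \<and> snd (\<gamma> u) = of_int d"
    by metis
  define G :: "(((nat \<Rightarrow>\<^sub>0 real) \<times> real) \<Rightarrow>\<^sub>0 'k) set"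
    where "G = (\<lambda>c. Poly_Mapping.single c 1) ` {c \<in> I. snd c = of_int d}"
  have "generated_submodule (semigroup_algebra P) G \<subseteq> canonical_module P"
  proof
    fix f assume "f \<in> generated_submodule (semigroup_algebra P) G"
    then obtain F a where F: "F \<subseteq> G" "\<forall>g\<in>F. a g \<in> semigroup_algebra P" and f: "f = (\<Sum>g\<in>F. a g * g)"
      unfolding generated_submodule_def by blast
    have "u \<in> I" if u: "u \<in> Poly_Mapping.keys f" for u
    proof -
      obtain g where g: "g \<in> F" "u \<in> Poly_Mapping.keys (a g * g)"
        using u keys_sum_subset[of "\<lambda>g. a g * g" F] unfolding f by blast
      then obtain p c where pc: "u = p + c" "p \<in> Poly_Mapping.keys (a g)" "c \<in> Poly_Mapping.keys g"
        using keys_mult[of "a g" g] by blast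
      have "p \<in> C"
        using pc g F by (auto simp: semigroup_algebra_def monomial_span_def C_def)
      moreover have "c \<in> I"
        using pc g F by (auto simp: G_def)
      ultimately show ?thesis
        using add pc(1) by (simp add: add.commute)
    qed
    then show "f \<in> canonical_module P"
      by (auto simp: canonical_module_def monomial_span_def I_def)
  qed
  moreover have "canonical_module P \<subseteq> generated_submodule (semigroup_algebra P) G"
  proof
    fix f :: "((nat \<Rightarrow>\<^sub>0 real) \<times> real) \<Rightarrow>\<^sub>0 'k" assume "f \<in> canonical_module P"
    then have keys: "Poly_Mapping.keys f \<subseteq> I"
      by (simp add: canonical_module_def monomial_span_def I_def)
    define g where "g u = (Poly_Mapping.single (\<gamma> u) 1 :: _ \<Rightarrow>\<^sub>0 'k)" for u
    define F where "F = g ` Poly_Mapping.keys f"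
    \<comment> \<open>Different exponents may share the same \<open>\<gamma> u\<close>. Since a
      generated element takes one coefficient per generator, their terms are collected in a single
      \<open>a b\<close>.\<close>
    define a where "a b = (\<Sum>u\<in>{u \<in> Poly_Mapping.keys f. g u = b}.
      Poly_Mapping.single (\<pi> u) (Poly_Mapping.lookup f u))" for b
    have "f = (\<Sum>u\<in>Poly_Mapping.keys f. Poly_Mapping.single u (Poly_Mapping.lookup f u))"
      by (simp add: sum_single_keys)
    also have "\<dots> = (\<Sum>u\<in>Poly_Mapping.keys f.
        Poly_Mapping.single (\<pi> u) (Poly_Mapping.lookup f u) * g u)"
    proof (rule sum.cong)
      fix u assume "u \<in> Poly_Mapping.keys f"
      then have "u = \<pi> u + \<gamma> u"
        using split keys by (metis add.commute subsetD)
      then show "Poly_Mapping.single u (Poly_Mapping.lookup f u) =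
          Poly_Mapping.single (\<pi> u) (Poly_Mapping.lookup f u) * g u"
        by (simp add: g_def mult_single)
    qed simp
    also have "\<dots> = (\<Sum>b\<in>F. \<Sum>u\<in>{u \<in> Poly_Mapping.keys f. g u = b}.
        Poly_Mapping.single (\<pi> u) (Poly_Mapping.lookup f u) * g u)"
      unfolding F_def by (rule sum.image_gen) simp
    also have "\<dots> = (\<Sum>b\<in>F. a b * b)"
      by (simp add: a_def sum_distrib_right)
    finally have f: "f = (\<Sum>b\<in>F. a b * b)" .
    have "F \<subseteq> G"
      using split keys by (auto simp: F_def G_def g_def)
    moreover have "a b \<in> semigroup_algebra P" for b
    proof -
      have "Poly_Mapping.keys (a b) \<subseteq> \<pi> ` Poly_Mapping.keys f"
        unfolding a_def by (rule order_trans[OF keys_sum_subset]) (auto split: if_splits)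
      then show ?thesis
        using split keys by (fastforce simp: semigroup_algebra_def monomial_span_def C_def)
    qed
    moreover have "finite F"
      by (simp add: F_def)
    ultimately show "f \<in> generated_submodule (semigroup_algebra P) G"
      using f unfolding generated_submodule_def by blast
  qed
  moreover have "G \<subseteq> canonical_module P" "\<forall>g\<in>G. homogeneous d g"
    by (auto simp: G_def canonical_module_def monomial_span_def I_def homogeneous_def)
  ultimately show "level TYPE('k) P"
    unfolding level_def by blast
qed

section \<open>The cone over a lecture hall polytope\<close>

lemma lookup_scaleR:
  fixes x :: "'a \<Rightarrow>\<^sub>0 'b::real_vector"
  shows "Poly_Mapping.lookup (c *\<^sub>R x) i = c *\<^sub>R Poly_Mapping.lookup x i"
proof -
  have "finite {i. c *\<^sub>R Poly_Mapping.lookup x i \<noteq> 0}"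
    by (rule finite_subset[OF _ finite_lookup[of x]]) auto
  then show ?thesis
    by (simp add: scaleR_poly_mapping_def)
qed

lemma norm_lookup_le:
  fixes x :: "'a \<Rightarrow>\<^sub>0 'b::real_normed_vector"
  shows "norm (Poly_Mapping.lookup x i) \<le> norm x"
proof (cases "i \<in> Poly_Mapping.keys x")
  case True
  then have "norm (Poly_Mapping.lookup x i) \<le> (\<Sum>j\<in>Poly_Mapping.keys x. norm (Poly_Mapping.lookup x j))"
    by (intro member_le_sum) auto
  then show ?thesis
    by (simp add: norm_poly_mapping_def dist_poly_mapping_def)
qed (simp add: in_keys_iff)

lemma bounded_linear_lookup:
  "bounded_linear (\<lambda>x :: 'a \<Rightarrow>\<^sub>0 'b::real_normed_vector. Poly_Mapping.lookup x i)"
  by (rule bounded_linear_intro[where K = 1])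
    (simp_all add: lookup_add lookup_scaleR norm_lookup_le)

definition ratio :: "nat list \<Rightarrow> nat \<Rightarrow> (nat \<Rightarrow>\<^sub>0 real) \<times> real \<Rightarrow> real" where
  "ratio s j u = (if j < length s then Poly_Mapping.lookup (fst u) j / real (s ! j) else snd u)"

text \<open>These are the facet functionals of the simplicial cone. At height 1 they are the
  barycentric coordinates of the simplex.\<close>

definition gap :: "nat list \<Rightarrow> nat \<Rightarrow> (nat \<Rightarrow>\<^sub>0 real) \<times> real \<Rightarrow> real" where
  "gap s j u = ratio s j u - (if j = 0 then 0 else ratio s (j - 1) u)"

text \<open>The finite-dimensional ambient space of the cone inside the infinite-dimensional
  type.\<close>

definition length_subspace :: "nat \<Rightarrow> ((nat \<Rightarrow>\<^sub>0 real) \<times> real) set" where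
  "length_subspace n = {u. Poly_Mapping.keys (fst u) \<subseteq> {..<n}}"

text \<open>The relation \<open>R\<close> is \<open>(\<le>)\<close> for the cone itself and \<open>(<)\<close> for its relative interior.\<close>

definition gap_cone :: "(real \<Rightarrow> real \<Rightarrow> bool) \<Rightarrow> nat list \<Rightarrow> ((nat \<Rightarrow>\<^sub>0 real) \<times> real) set" where
  "gap_cone R s = {u \<in> length_subspace (length s). \<forall>j\<le>length s. R 0 (gap s j u)}"

lemma bounded_linear_ratio: "bounded_linear (ratio s j)"
proof (cases "j < length s")
  case True
  then have "ratio s j = (\<lambda>u. Poly_Mapping.lookup (fst u) j / real (s ! j))"
    by (simp add: ratio_def fun_eq_iff)
  moreover have "bounded_linear (\<lambda>u::(nat \<Rightarrow>\<^sub>0 real) \<times> real. Poly_Mapping.lookup (fst u) j / real (s ! j))"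
    using bounded_linear_compose[OF bounded_linear_divide
        bounded_linear_compose[OF bounded_linear_lookup bounded_linear_fst]] .
  ultimately show ?thesis
    by simp
next
  case False
  then have "ratio s j = snd"
    by (simp add: ratio_def fun_eq_iff)
  then show ?thesis
    by (simp add: bounded_linear_snd)
qed

lemma bounded_linear_gap: "bounded_linear (gap s j)"
proof (cases "j = 0")
  case True
  then have "gap s j = ratio s j"
    by (simp add: gap_def fun_eq_iff)
  then show ?thesis
    by (simp add: bounded_linear_ratio)
next
  case False
  then have "gap s j = (\<lambda>u. ratio s j u - ratio s (j - 1) u)"
    by (simp add: gap_def fun_eq_iff)
  then show ?thesis
    by (simp add: bounded_linear_ratio bounded_linear_sub)
qed

lemmas linear_gap = bounded_linear.linear[OF bounded_linear_gap]

lemmas gap_linear_simps =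
  linear_add[OF linear_gap] linear_diff[OF linear_gap] linear_scale[OF linear_gap]
  linear_sum[OF linear_gap]

lemma length_subspace_iff:
  "u \<in> length_subspace n \<longleftrightarrow> (\<forall>i\<ge>n. Poly_Mapping.lookup (fst u) i = 0)"
  by (simp add: length_subspace_def subset_iff in_keys_iff) (meson not_less)

lemma subspace_length_subspace: "subspace (length_subspace n)"
  by (simp add: subspace_def length_subspace_iff lookup_add lookup_scaleR)

text \<open>The sum telescopes. At \<open>j = length s\<close> it says that all gaps together add up
  to the height.\<close>

lemma sum_gap: "(\<Sum>i\<le>j. gap s i u) = ratio s j u"
  by (induction j) (auto simp: gap_def)

text \<open>Partial sums of gaps recover the ratios, and positive entries of \<open>s\<close> let
  the ratios recover the coordinates. The gaps thus serve as a coordinate system.\<close>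

lemma length_subspace_eqI:
  assumes pos: "\<forall>a\<in>set s. a \<ge> 1"
    and u: "u \<in> length_subspace (length s)" and v: "v \<in> length_subspace (length s)"
    and gap: "\<And>j. j \<le> length s \<Longrightarrow> gap s j u = gap s j v"
  shows "u = v"
proof -
  have ratio: "ratio s j u = ratio s j v" if "j \<le> length s" for j
    using that gap unfolding sum_gap[symmetric] by (intro sum.cong) auto
  have "Poly_Mapping.lookup (fst u) i = Poly_Mapping.lookup (fst v) i" for i
  proof (cases "i < length s")
    case True
    then have "s ! i \<noteq> 0"
      using pos nth_mem by fastforce
    then show ?thesis
      using ratio[of i] True by (simp add: ratio_def)
  next
    case False
    then show ?thesis
      using u v by (simp add: length_subspace_iff)
  qed
  moreover have "snd u = snd v"
    using ratio[of "length s"] by (simp add: ratio_def)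
  ultimately show ?thesis
    by (simp add: prod_eq_iff poly_mapping_eqI)
qed

lemma lecture_hall_polytope_iff:
  "x \<in> lecture_hall_polytope s \<longleftrightarrow> (x, 1) \<in> gap_cone (\<le>) s"
proof -
  let ?n = "length s"
  define xs where "xs = 0 # map (\<lambda>i. Poly_Mapping.lookup x i / real (s ! i)) [0..<?n] @ [1]"
  \<comment> \<open>At height 1 the closing entry 1 is the ratio with index \<open>length s\<close>,
    so the bound on the last coordinate becomes one more gap.\<close>
  have xs: "xs = 0 # map (\<lambda>j. ratio s j (x, 1)) [0..<Suc ?n]"
    by (simp add: xs_def ratio_def)
  have "xs ! Suc j - xs ! j = gap s j (x, 1)" if "j \<le> ?n" for j
    using that by (cases j) (simp_all add: xs gap_def del: upt_Suc)
  moreover have "sorted xs \<longleftrightarrow> (\<forall>j\<le>?n. 0 \<le> xs ! Suc j - xs ! j)"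
    unfolding sorted_iff_nth_Suc by (simp add: xs_def less_Suc_eq_le)
  ultimately have "sorted xs \<longleftrightarrow> (\<forall>j\<le>?n. 0 \<le> gap s j (x, 1))"
    by simp
  then show ?thesis
    by (simp add: lecture_hall_polytope_def gap_cone_def length_subspace_def xs_def)
qed

section \<open>The vertices of the simplex\<close>

definition lecture_hall_vertex :: "nat list \<Rightarrow> nat \<Rightarrow> nat \<Rightarrow>\<^sub>0 real" where
  "lecture_hall_vertex s j =
     Abs_poly_mapping (\<lambda>i. if j \<le> i \<and> i < length s then real (s ! i) else 0)"

lemma lookup_lecture_hall_vertex:
  "Poly_Mapping.lookup (lecture_hall_vertex s j) i = (if j \<le> i \<and> i < length s then real (s ! i) else 0)"
  unfolding lecture_hall_vertex_def by (subst lookup_Abs_poly_mapping) auto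

lemma vertex_in_length_subspace: "(lecture_hall_vertex s j, h) \<in> length_subspace (length s)"
  by (simp add: length_subspace_iff lookup_lecture_hall_vertex)

text \<open>The ratios of vertex \<open>j\<close> jump from 0 to 1 exactly at index
  \<open>j\<close>; for \<open>j = length s\<close> the vertex is the origin and the jump is at the
  height. The lifted vertices are therefore dual to the gaps.\<close>

lemma gap_vertex:
  assumes pos: "\<forall>a\<in>set s. a \<ge> 1" and "i \<le> length s" "j \<le> length s"
  shows "gap s i (lecture_hall_vertex s j, 1) = (if i = j then 1 else 0)"
proof -
  have "ratio s k (lecture_hall_vertex s j, 1) = (if j \<le> k then 1 else 0)" for k
  proof (cases "k < length s")
    case True
    then have "s ! k \<noteq> 0"
      using pos nth_mem by fastforce
    with True show ?thesis
      by (simp add: ratio_def lookup_lecture_hall_vertex)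
  qed (use assms in \<open>simp add: ratio_def\<close>)
  then show ?thesis
    by (auto simp: gap_def)
qed

text \<open>All gaps but the \<open>j\<close>-th vanish at the vertex. Being nonnegative on the
  polytope, they vanish at both ends of a segment through it, and the gap left over equals the
  height 1 there, so the two ends coincide.\<close>

lemma extreme_point_vertex:
  assumes pos: "\<forall>a\<in>set s. a \<ge> 1" and j: "j \<le> length s"
  shows "lecture_hall_vertex s j extreme_point_of lecture_hall_polytope s"
  unfolding extreme_point_of_def
proof (intro conjI ballI)
  show "lecture_hall_vertex s j \<in> lecture_hall_polytope s"
    using gap_vertex[OF pos _ j]
    by (simp add: lecture_hall_polytope_iff gap_cone_def vertex_in_length_subspace)
next
  fix a b assume a: "a \<in> lecture_hall_polytope s" and b: "b \<in> lecture_hall_polytope s"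
  show "lecture_hall_vertex s j \<notin> open_segment a b"
  proof
    assume "lecture_hall_vertex s j \<in> open_segment a b"
    then obtain r where "a \<noteq> b" and r: "0 < r" "r < 1"
      and v: "lecture_hall_vertex s j = (1 - r) *\<^sub>R a + r *\<^sub>R b"
      by (auto simp: in_segment)
    have v1: "(lecture_hall_vertex s j, 1) = (1 - r) *\<^sub>R (a, 1) + r *\<^sub>R (b, 1)"
      by (simp add: v)
    have zero: "gap s i (a, 1) = 0 \<and> gap s i (b, 1) = 0" if i: "i \<le> length s" "i \<noteq> j" for i
    proof -
      have "0 = (1 - r) * gap s i (a, 1) + r * gap s i (b, 1)"
        using gap_vertex[OF pos i(1) j] i(2) by (simp add: v1 gap_linear_simps del: add_Pair scaleR_Pair)
      moreover have "0 \<le> gap s i (a, 1)" "0 \<le> gap s i (b, 1)"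
        using a b i by (auto simp: lecture_hall_polytope_iff gap_cone_def)
      ultimately show ?thesis
        using r by (smt (verit) mult_pos_pos mult_nonneg_nonneg)
    qed
    have one: "gap s j u = snd u" if "\<And>i. i \<le> length s \<Longrightarrow> i \<noteq> j \<Longrightarrow> gap s i u = 0" for u
    proof -
      have "snd u = (\<Sum>i\<le>length s. gap s i u)"
        by (simp add: sum_gap ratio_def)
      also have "\<dots> = (\<Sum>i\<in>{j}. gap s i u)"
        using that j by (intro sum.mono_neutral_right) auto
      finally show ?thesis
        by simp
    qed
    have "(a, 1::real) = (b, 1)"
    proof (rule length_subspace_eqI[OF pos])
      fix i assume "i \<le> length s"
      then show "gap s i (a, 1) = gap s i (b, 1)"
        using zero one[of "(a, 1)"] one[of "(b, 1)"] by (cases "i = j") auto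
    qed (use a b in \<open>auto simp: lecture_hall_polytope_iff gap_cone_def\<close>)
    with \<open>a \<noteq> b\<close> show False
      by simp
  qed
qed

section \<open>The cone spanned by the vertices and its relative interior\<close>

lemma convex_cone_sum:
  assumes "convex_cone S" "\<And>i. i \<in> A \<Longrightarrow> f i \<in> S"
  shows "sum f A \<in> S"
  using assms(2)
  by (induction A rule: infinite_finite_induct)
    (auto simp: convex_cone_contains_0[OF assms(1)] intro: convex_cone_add[OF assms(1)])

lemma convex_cone_gap_cone: "convex_cone (gap_cone (\<le>) s)"
proof -
  have "gap_cone (\<le>) s =
      \<Inter> (insert (length_subspace (length s)) ((\<lambda>j. {u. 0 \<le> gap s j u}) ` {..length s}))"
    by (auto simp: gap_cone_def)
  moreover have "convex_cone {u. 0 \<le> gap s j u}" for j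
    by (auto simp: convex_cone_iff gap_linear_simps linear_0[OF linear_gap] intro: exI[of _ 0])
  ultimately show ?thesis
    using subspace_imp_convex_cone[OF subspace_length_subspace]
    by (simp only:) (rule convex_cone_Inter, auto)
qed

lemma cone_over_lecture_hall:
  assumes pos: "\<forall>a\<in>set s. a \<ge> 1"
  shows "cone_over (lecture_hall_polytope s) = gap_cone (\<le>) s"
proof
  show "cone_over (lecture_hall_polytope s) \<subseteq> gap_cone (\<le>) s"
    unfolding cone_over_def
    by (rule hull_minimal)
      (auto simp: convex_cone_gap_cone extreme_point_of_def lecture_hall_polytope_iff)
next
  let ?H = "cone_over (lecture_hall_polytope s)"
  have cone: "convex_cone ?H"
    unfolding cone_over_def by (rule convex_cone_convex_cone_hull)
  show "gap_cone (\<le>) s \<subseteq> ?H"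
  proof
    fix u assume u: "u \<in> gap_cone (\<le>) s"
    \<comment> \<open>By duality the only possible coefficients of \<open>u\<close> in the lifted
      vertices are its gaps, which are nonnegative on the cone.\<close>
    define v where "v = (\<Sum>j\<le>length s. gap s j u *\<^sub>R (lecture_hall_vertex s j, 1::real))"
    have "u = v"
    proof (rule length_subspace_eqI[OF pos])
      show "v \<in> length_subspace (length s)"
        unfolding v_def by (intro subspace_sum subspace_scale subspace_length_subspace
            vertex_in_length_subspace)
      fix i assume i: "i \<le> length s"
      have "gap s i v = (\<Sum>j\<le>length s. gap s j u * (if i = j then 1 else 0))"
        unfolding v_def linear_sum[OF linear_gap] linear_scale[OF linear_gap]
        by (intro sum.cong) (auto simp: gap_vertex[OF pos i])
      also have "\<dots> = gap s i u"
        using i by (simp add: if_distrib cong: if_cong)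
      finally show "gap s i u = gap s i v" ..
    qed (use u in \<open>simp add: gap_cone_def\<close>)
    also have "v \<in> ?H"
      unfolding v_def
    proof (intro convex_cone_sum[OF cone] convex_cone_scaleR[OF cone])
      fix j assume "j \<in> {..length s}"
      then show "(lecture_hall_vertex s j, 1) \<in> ?H"
        unfolding cone_over_def by (intro hull_inc) (auto intro: extreme_point_vertex[OF pos])
    qed (use u in \<open>simp add: gap_cone_def\<close>)
    finally show "u \<in> ?H" .
  qed
qed

text \<open>Strict inequalities between continuous functionals are open conditions. Conversely, an
  interior point stays in the cone after a small step that lowers every gap by the same positive
  amount.\<close>

lemma rel_interior_gap_cone:
  assumes pos: "\<forall>a\<in>set s. a \<ge> 1"
  shows "rel_interior (gap_cone (\<le>) s) = gap_cone (<) s"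
proof
  let ?C = "gap_cone (\<le>) s"
  have aff: "affine hull ?C = span ?C"
    using convex_cone_contains_0[OF convex_cone_gap_cone] by (simp add: affine_hull_span_0 hull_inc)
  show "gap_cone (<) s \<subseteq> rel_interior ?C"
  proof
    fix u assume u: "u \<in> gap_cone (<) s"
    define T where "T = (\<Inter>j\<in>{..length s}. {v. 0 < gap s j v})"
    have "open T"
      unfolding T_def
      by (intro open_INT finite_atMost ballI open_Collect_less continuous_intros
          linear_continuous_on bounded_linear_gap)
    moreover have "u \<in> T \<inter> ?C"
      using u by (auto simp: T_def gap_cone_def less_imp_le)
    moreover have "span ?C \<subseteq> length_subspace (length s)"
      by (intro span_minimal subspace_length_subspace) (auto simp: gap_cone_def)
    then have "T \<inter> affine hull ?C \<subseteq> ?C"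
      unfolding aff by (auto simp: T_def gap_cone_def less_imp_le)
    ultimately show "u \<in> rel_interior ?C"
      unfolding mem_rel_interior by blast
  qed
  show "rel_interior ?C \<subseteq> gap_cone (<) s"
  proof
    fix u assume "u \<in> rel_interior ?C"
    then obtain e where u: "u \<in> ?C" and e: "e > 0" "ball u e \<inter> span ?C \<subseteq> ?C"
      unfolding mem_rel_interior_ball aff by blast
    \<comment> \<open>The sum of all lifted vertices has every gap equal to 1, so subtracting
      \<open>r *\<^sub>R p\<close> lowers each gap by exactly \<open>r\<close>.\<close>
    define p where "p = (\<Sum>j\<le>length s. (lecture_hall_vertex s j, 1::real))"
    have gap_p: "gap s i p = 1" if i: "i \<le> length s" for i
    proof -
      have "gap s i p = (\<Sum>j\<le>length s. if i = j then 1 else 0)"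
        unfolding p_def linear_sum[OF linear_gap]
        by (intro sum.cong) (auto simp: gap_vertex[OF pos i])
      then show ?thesis
        using i by simp
    qed
    then have p: "p \<in> ?C"
      unfolding gap_cone_def p_def
      by (auto intro: subspace_sum subspace_length_subspace vertex_in_length_subspace)
    \<comment> \<open>The summand 1 keeps the denominator positive and makes the first norm estimate
      strict.\<close>
    define r where "r = e / (2 * (norm p + 1))"
    have r: "0 < r"
      using e(1) by (simp add: r_def add_nonneg_pos)
    have "norm (r *\<^sub>R p) < r * (norm p + 1)"
      using r by simp
    also have "\<dots> = e / 2"
      using norm_ge_zero[of p] by (simp add: r_def field_simps add_nonneg_eq_0_iff)
    also have "\<dots> < e"
      using e(1) by simp
    finally have "norm (r *\<^sub>R p) < e" .
    then have "u - r *\<^sub>R p \<in> ball u e"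
      by (simp add: dist_norm)
    moreover have "u - r *\<^sub>R p \<in> span ?C"
      using u p by (simp add: span_diff span_scale span_base)
    ultimately have "u - r *\<^sub>R p \<in> ?C"
      using e(2) by blast
    then have "0 \<le> gap s j u - r" if "j \<le> length s" for j
      using that gap_p[OF that] by (auto simp: gap_cone_def gap_linear_simps)
    then show "u \<in> gap_cone (<) s"
      using u r by (fastforce simp: gap_cone_def)
  qed
qed

lemma gap_cone_add:
  assumes "u \<in> gap_cone (<) s" "v \<in> gap_cone (\<le>) s"
  shows "u + v \<in> gap_cone (<) s"
  using assms by (auto simp: gap_cone_def gap_linear_simps add_pos_nonneg
      intro: subspace_add[OF subspace_length_subspace])

lemma lattice_points_add: "u \<in> lattice_points \<Longrightarrow> v \<in> lattice_points \<Longrightarrow> u + v \<in> lattice_points"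
  by (auto simp: lattice_points_def lookup_add)

lemma level_lecture_hall_iff:
  assumes pos: "\<forall>a\<in>set s. a \<ge> 1"
  shows "level TYPE('k::{alg_closed_field, field_char_0}) (lecture_hall_polytope s) \<longleftrightarrow>
    (\<exists>d::int. \<forall>u\<in>gap_cone (<) s \<inter> lattice_points. \<exists>c\<in>gap_cone (<) s \<inter> lattice_points.
       \<exists>p\<in>gap_cone (\<le>) s \<inter> lattice_points. u = c + p \<and> snd c = of_int d)"
  by (subst level_iff)
    (auto simp: cone_over_lecture_hall[OF pos] rel_interior_gap_cone[OF pos]
      intro: gap_cone_add lattice_points_add)

section \<open>Cutting at an entry 1\<close>

text \<open>The inverse of the cut at the entry 1. The height of \<open>u\<close> becomes the
  coordinate at that entry, and \<open>v\<close> is raised by this height times \<open>t\<close>, so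
  that its ratios start from there instead of from 0.\<close>

definition glue :: "nat list \<Rightarrow> nat list \<Rightarrow> (nat \<Rightarrow>\<^sub>0 real) \<times> real \<Rightarrow> (nat \<Rightarrow>\<^sub>0 real) \<times> real \<Rightarrow>
    (nat \<Rightarrow>\<^sub>0 real) \<times> real" where
  "glue s t u v =
     (Abs_poly_mapping (\<lambda>i.
        if i < length s then Poly_Mapping.lookup (fst u) i
        else if i = length s then snd u
        else if i < Suc (length s + length t)
          then Poly_Mapping.lookup (fst v) (i - Suc (length s)) + snd u * real (t ! (i - Suc (length s)))
        else 0),
      snd u + snd v)"

lemma lookup_glue:
  "Poly_Mapping.lookup (fst (glue s t u v)) i =
     (if i < length s then Poly_Mapping.lookup (fst u) i
      else if i = length s then snd u
      else if i < Suc (length s + length t)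
        then Poly_Mapping.lookup (fst v) (i - Suc (length s)) + snd u * real (t ! (i - Suc (length s)))
      else 0)"
proof -
  have "finite {i. (if i < length s then Poly_Mapping.lookup (fst u) i
      else if i = length s then snd u
      else if i < Suc (length s + length t)
        then Poly_Mapping.lookup (fst v) (i - Suc (length s)) + snd u * real (t ! (i - Suc (length s)))
      else 0) \<noteq> 0}"
    by (rule finite_subset[of _ "{..length s + length t}"]) (auto split: if_splits)
  then show ?thesis
    by (simp add: glue_def)
qed

lemma snd_glue: "snd (glue s t u v) = snd u + snd v"
  by (simp add: glue_def)

text \<open>The shift by \<open>snd u\<close> times \<open>t\<close> is linear in \<open>u\<close>,
  so sums can be glued summand by summand.\<close>

lemma glue_add: "glue s t (u + u') (v + v') = glue s t u v + glue s t u' v'"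
  by (auto simp: prod_eq_iff snd_glue lookup_glue lookup_add algebra_simps intro!: poly_mapping_eqI)

lemma glue_in_lattice_points:
  assumes "u \<in> lattice_points" "v \<in> lattice_points"
  shows "glue s t u v \<in> lattice_points"
proof -
  have "\<forall>i. Poly_Mapping.lookup (fst (glue s t u v)) i \<in> \<int>" "snd (glue s t u v) \<in> \<int>"
    using assms by (auto simp: lattice_points_def lookup_glue snd_glue)
  then show ?thesis
    unfolding lattice_points_def by (cases "glue s t u v") simp
qed

lemma ratio_glue:
  assumes "\<forall>a\<in>set t. a \<ge> 1"
  shows "ratio (s @ [1] @ t) j (glue s t u v) =
    (if j \<le> length s then ratio s j u else snd u + ratio t (j - Suc (length s)) v)"
proof -
  consider "j < length s" | "j = length s" | k where "j = Suc (length s + k)"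
    by (metis less_iff_Suc_add linorder_neqE_nat)
  then show ?thesis
  proof cases
    case 3
    have "t ! k \<noteq> 0" if "k < length t"
      using assms that nth_mem by fastforce
    then show ?thesis
      by (auto simp: 3 ratio_def lookup_glue snd_glue nth_append add_divide_distrib)
  qed (simp_all add: ratio_def lookup_glue nth_append)
qed

text \<open>The gaps of the glued point are those of \<open>u\<close> followed by those of
  \<open>v\<close>, because the common shift \<open>snd u\<close> cancels in differences. At the
  first index of the second block it cancels against the ratio at the entry 1.\<close>

lemma gap_glue:
  assumes "\<forall>a\<in>set t. a \<ge> 1"
  shows "gap (s @ [1] @ t) j (glue s t u v) =
    (if j \<le> length s then gap s j u else gap t (j - Suc (length s)) v)"
proof -
  consider "j \<le> length s" | "j = Suc (length s)" | k where "j = Suc (Suc (length s) + k)"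
    by (metis less_iff_Suc_add linorder_neqE_nat less_Suc_eq_le)
  then show ?thesis
  proof cases
    case 2
    moreover have "ratio s (length s) u = snd u"
      by (simp add: ratio_def)
    ultimately show ?thesis
      by (simp add: gap_def ratio_glue[OF assms, simplified])
  qed (auto simp: gap_def ratio_glue[OF assms, simplified])
qed

text \<open>Keeping \<open>R\<close> arbitrary covers the cone and its interior at once. Since
  \<open>glue\<close> ignores coordinates beyond the lengths of \<open>s\<close> and
  \<open>t\<close>, membership in the two subspaces has to be assumed.\<close>

lemma glue_in_gap_cone_iff:
  assumes "\<forall>a\<in>set t. a \<ge> 1"
    and "u \<in> length_subspace (length s)" "v \<in> length_subspace (length t)"
  shows "glue s t u v \<in> gap_cone R (s @ [1] @ t) \<longleftrightarrow> u \<in> gap_cone R s \<and> v \<in> gap_cone R t"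
proof -
  have "glue s t u v \<in> length_subspace (length (s @ [1] @ t))"
    by (simp add: length_subspace_iff lookup_glue)
  moreover have "(\<forall>j\<le>length (s @ [1] @ t). R 0 (gap (s @ [1] @ t) j (glue s t u v))) \<longleftrightarrow>
    (\<forall>j\<le>length s. R 0 (gap s j u)) \<and> (\<forall>j\<le>length t. R 0 (gap t j v))" (is "?L \<longleftrightarrow> ?R")
  proof
    assume L: ?L
    have "R 0 (gap s j u)" if "j \<le> length s" for j
      using L[rule_format, of j] that by (simp only: gap_glue[OF assms(1)]) simp
    moreover have "R 0 (gap t j v)" if "j \<le> length t" for j
      using L[rule_format, of "Suc (length s + j)"] that by (simp only: gap_glue[OF assms(1)]) simp
    ultimately show ?R
      by blast
  next
    assume ?R
    then show ?L
      by (auto simp only: gap_glue[OF assms(1)]) simp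
  qed
  ultimately show ?thesis
    using assms(2,3) by (simp add: gap_cone_def)
qed

text \<open>The entry 1 matters here: the ratio at that place is the coordinate itself, hence an
  integer, and can serve as the height of the left piece. Subtracting this integer multiple of
  \<open>t\<close> keeps the right piece integral.\<close>

lemma lattice_point_glueE:
  assumes w: "w \<in> length_subspace (length (s @ [1] @ t))" "w \<in> lattice_points"
  obtains u v where "w = glue s t u v" "u \<in> length_subspace (length s)" "u \<in> lattice_points"
    "v \<in> length_subspace (length t)" "v \<in> lattice_points"
proof -
  define k where "k = Poly_Mapping.lookup (fst w) (length s)"
  define x where "x = Abs_poly_mapping (\<lambda>i. if i < length s then Poly_Mapping.lookup (fst w) i else 0)"
  define y where "y = Abs_poly_mapping (\<lambda>i. if i < length t
    then Poly_Mapping.lookup (fst w) (Suc (length s + i)) - k * real (t ! i) else 0)"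
  have x: "Poly_Mapping.lookup x i = (if i < length s then Poly_Mapping.lookup (fst w) i else 0)" for i
    unfolding x_def by (subst lookup_Abs_poly_mapping) auto
  have y: "Poly_Mapping.lookup y i = (if i < length t
      then Poly_Mapping.lookup (fst w) (Suc (length s + i)) - k * real (t ! i) else 0)" for i
    unfolding y_def by (subst lookup_Abs_poly_mapping) auto
  have int: "Poly_Mapping.lookup (fst w) i \<in> \<int>" "snd w \<in> \<int>" for i
    using w(2) by (auto simp: lattice_points_def)
  then have "k \<in> \<int>"
    by (simp add: k_def)
  have "Poly_Mapping.lookup (fst w) i = Poly_Mapping.lookup (fst (glue s t (x, k) (y, snd w - k))) i" for i
  proof -
    have "Poly_Mapping.lookup (fst w) i = 0" if "i \<ge> Suc (length s + length t)"
      using w(1) that by (simp add: length_subspace_iff)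
    then show ?thesis
      by (auto simp: lookup_glue x y k_def)
  qed
  then have "w = glue s t (x, k) (y, snd w - k)"
    by (simp add: prod_eq_iff poly_mapping_eqI snd_glue)
  moreover have "(x, k) \<in> length_subspace (length s)" "(y, snd w - k) \<in> length_subspace (length t)"
    by (simp_all add: length_subspace_iff x y)
  moreover have "(x, k) \<in> lattice_points" "(y, snd w - k) \<in> lattice_points"
    using int \<open>k \<in> \<int>\<close> by (auto simp: lattice_points_def x y)
  ultimately show ?thesis
    using that by blast
qed

theorem corollary26:
  fixes s t :: "nat list"
  assumes "\<forall>x \<in> set s. x \<ge> 1" and "\<forall>x \<in> set t. x \<ge> 1"
    and "level TYPE('k::{alg_closed_field, field_char_0}) (lecture_hall_polytope s)"
    and "level TYPE('k) (lecture_hall_polytope t)"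
  shows "level TYPE('k) (lecture_hall_polytope (s @ [1] @ t))"
proof -
  obtain d :: int where d: "\<And>u. u \<in> gap_cone (<) s \<inter> lattice_points \<Longrightarrow>
      \<exists>c\<in>gap_cone (<) s \<inter> lattice_points. \<exists>p\<in>gap_cone (\<le>) s \<inter> lattice_points.
        u = c + p \<and> snd c = of_int d"
    using assms(3) unfolding level_lecture_hall_iff[OF assms(1)] by blast
  obtain e :: int where e: "\<And>u. u \<in> gap_cone (<) t \<inter> lattice_points \<Longrightarrow>
      \<exists>c\<in>gap_cone (<) t \<inter> lattice_points. \<exists>p\<in>gap_cone (\<le>) t \<inter> lattice_points.
        u = c + p \<and> snd c = of_int e"
    using assms(4) unfolding level_lecture_hall_iff[OF assms(2)] by blast
  let ?r = "s @ [1] @ t"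
  \<comment> \<open>Used with \<open>(<)\<close> for the interior summands and with
    \<open>(\<le>)\<close> for the cone summands.\<close>
  have glue: "glue s t u v \<in> gap_cone R ?r \<inter> lattice_points"
    if "u \<in> gap_cone R s \<inter> lattice_points" "v \<in> gap_cone R t \<inter> lattice_points" for R u v
    using that glue_in_gap_cone_iff[OF assms(2), of u s v R]
    by (auto simp: gap_cone_def[of _ s] gap_cone_def[of _ t] glue_in_lattice_points)
  \<comment> \<open>Heights add under gluing, so generators of degrees \<open>d\<close> and
    \<open>e\<close> glue to generators of the single degree \<open>d + e\<close>.\<close>
  have "\<exists>c\<in>gap_cone (<) ?r \<inter> lattice_points. \<exists>p\<in>gap_cone (\<le>) ?r \<inter> lattice_points.
      w = c + p \<and> snd c = of_int (d + e)"
    if w: "w \<in> gap_cone (<) ?r \<inter> lattice_points" for w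
  proof -
    have "w \<in> length_subspace (length ?r)" "w \<in> lattice_points"
      using w by (auto simp: gap_cone_def)
    then obtain u v where w_eq: "w = glue s t u v"
      and "u \<in> length_subspace (length s)" and lat_u: "u \<in> lattice_points"
      and "v \<in> length_subspace (length t)" and lat_v: "v \<in> lattice_points"
      by (rule lattice_point_glueE)
    then have "u \<in> gap_cone (<) s" "v \<in> gap_cone (<) t"
      using w glue_in_gap_cone_iff[OF assms(2)] by auto
    with lat_u lat_v d[of u] e[of v] obtain c p c' p' where
      c: "c \<in> gap_cone (<) s \<inter> lattice_points" "c' \<in> gap_cone (<) t \<inter> lattice_points"
      and p: "p \<in> gap_cone (\<le>) s \<inter> lattice_points" "p' \<in> gap_cone (\<le>) t \<inter> lattice_points"
      and eq: "u = c + p" "v = c' + p'" "snd c = of_int d" "snd c' = of_int e"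
      by blast
    have "w = glue s t c c' + glue s t p p'" "snd (glue s t c c') = of_int (d + e)"
      by (simp_all add: w_eq eq glue_add snd_glue)
    then show ?thesis
      using glue[OF c] glue[OF p] by blast
  qed
  moreover have "\<forall>x\<in>set ?r. x \<ge> 1"
    using assms(1,2) by auto
  ultimately show ?thesis
    using level_lecture_hall_iff[of ?r] by blast
qed

end
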